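(* Let $n, d_1, d_2 \ge 1$ be integers and let $(X_{t_1}, Y_{t_1}), \ldots, (X_{t_n}, Y_{t_n})$ be observations with $X_{t_j} \in [-\pi,\pi]^{d_1}$ and $Y_{t_j} \in \mathbb{R}^{d_2}$. For $1 \le \ell \le d_2$ let $D_\ell \ge 1$ be an integer and let $\phi_\ell : [-\pi,\pi]^{d_1} \to \mathbb{C}^{D_\ell}$ be a map. Put $\dim(\theta) = D_1 + \cdots + D_{d_2}$, and for $\theta = (\theta_1, \ldots, \theta_{d_2}) \in \mathbb{C}^{\dim(\theta)}$ with $\theta_\ell \in \mathbb{C}^{D_\ell}$ let $f_\theta(x) = (\langle \phi_1(x), \theta_1\rangle, \ldots, \langle \phi_{d_2}(x), \theta_{d_2}\rangle)$. Let $\Lambda$ be a complex matrix with $d_2$ columns and $M$ a complex matrix with $\dim(\theta)$ columns (neither necessarily square). Suppose that both $M$ and $\Lambda$ are injective. Then the empirical risk $$L(\theta) = \frac{1}{n}\sum_{j=1}^n \|\Lambda(f_\theta(X_{t_j})-Y_{t_j})\|_2^2 + \|M\theta\|_2^2, \qquad \theta \in \mathbb{C}^{\dim(\theta)},$$ has a unique minimizer, and it is given by $$\hat\theta = \Big( \Big( \sum_{j=1}^n \Phi_{t_j}^\ast \Lambda^\ast \Lambda \Phi_{t_j}\Big) + n M^\ast M\Big)^{-1} \sum_{j=1}^n \Phi_{t_j}^\ast \Lambda^\ast \Lambda Y_{t_j},$$ where $\Phi_{t}$ is the $d_2 \times \dim(\theta)$ block-diagonal matrix whose $\ell$-th diagonal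 block is the row vector $\phi_\ell(X_{t})^\ast$, for $1 \le \ell \le d_2$.
   Context: $^\ast$ denotes the conjugate transpose. The inner product is $\langle u, v\rangle = u^\ast v$ (linear in the second argument), so that $f_\theta(X_t) = \Phi_t\theta$. $\|\cdot\|_2$ is the Euclidean (Hermitian) norm. A matrix is called injective if the linear map it defines is injective. *)

theory Defs
  imports
    "HOL-Analysis.L2_Norm"
    "Jordan_Normal_Form.Gauss_Jordan_Elimination"
    "Jordan_Normal_Form.Schur_Decomposition"
begin

text \<open>
  All indices start at 0, and the observation \<open>(X\<^bsub>t\<^sub>j\<^esub>, Y\<^bsub>t\<^sub>j\<^esub>)\<close> is written \<open>(X j, Y j)\<close>.
\<close>

definition cube :: "nat \<Rightarrow> real vec set" where
  "cube d = {x \<in> carrier_vec d. \<forall>i<d. x $ i \<in> {- pi..pi}}"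

text \<open>Conjugate-linear in the first argument, unlike \<open>\<bullet>c\<close>.\<close>

definition herm_inner :: "complex vec \<Rightarrow> complex vec \<Rightarrow> complex" where
  "herm_inner u v = conjugate u \<bullet> v"

definition euclid_norm :: "complex vec \<Rightarrow> real" where
  "euclid_norm v = L2_set (\<lambda>i. cmod (v $ i)) {..<dim_vec v}"

definition injective_mat :: "complex mat \<Rightarrow> bool" where
  "injective_mat A \<longleftrightarrow> inj_on (\<lambda>v. A *\<^sub>v v) (carrier_vec (dim_col A))"

text \<open>
  \<open>\<theta>\<close> is the concatenation of its blocks, so \<open>\<theta>\<^sub>l\<close> starts at offset \<open>D 0 + \<dots> + D (l - 1)\<close>.
\<close>

definition theta_block :: "(nat \<Rightarrow> nat) \<Rightarrow> nat \<Rightarrow> complex vec \<Rightarrow> complex vec" where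
  "theta_block D l \<theta> = vec (D l) (\<lambda>i. \<theta> $ ((\<Sum>k<l. D k) + i))"

definition model ::
  "nat \<Rightarrow> (nat \<Rightarrow> nat) \<Rightarrow> (nat \<Rightarrow> real vec \<Rightarrow> complex vec) \<Rightarrow> complex vec \<Rightarrow> real vec \<Rightarrow> complex vec"
  where
  "model d2 D \<phi> \<theta> x = vec d2 (\<lambda>l. herm_inner (\<phi> l x) (theta_block D l \<theta>))"

definition feature_mat ::
  "nat \<Rightarrow> (nat \<Rightarrow> nat) \<Rightarrow> (nat \<Rightarrow> real vec \<Rightarrow> complex vec) \<Rightarrow> real vec \<Rightarrow> complex mat"
  where
  "feature_mat d2 D \<phi> x =
    diag_block_mat (map (\<lambda>l. mat_of_rows (D l) [conjugate (\<phi> l x)]) [0..<d2])"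

definition emp_risk ::
  "nat \<Rightarrow> nat \<Rightarrow> (nat \<Rightarrow> nat) \<Rightarrow> (nat \<Rightarrow> real vec \<Rightarrow> complex vec) \<Rightarrow> (nat \<Rightarrow> real vec) \<Rightarrow>
    (nat \<Rightarrow> real vec) \<Rightarrow> complex mat \<Rightarrow> complex mat \<Rightarrow> complex vec \<Rightarrow> real"
  where
  "emp_risk n d2 D \<phi> X Y \<Lambda> M \<theta> =
    1 / real n * (\<Sum>j<n. (euclid_norm (\<Lambda> *\<^sub>v (model d2 D \<phi> \<theta> (X j) - map_vec complex_of_real (Y j))))\<^sup>2)
    + (euclid_norm (M *\<^sub>v \<theta>))\<^sup>2"

end

theory Submission
  imports Defs
begin

text \<open>
  The matrix \<open>A\<close> represents the positive definite Hermitian form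
  \<open>(h, v) \<mapsto> \<Sum>\<^sub>j \<langle>\<Lambda> \<Phi>\<^sub>j h, \<Lambda> \<Phi>\<^sub>j v\<rangle> + n \<langle>M h, M v\<rangle>\<close>, so it is invertible. Since
  \<open>\<theta>hat\<close> solves the normal equations, the cross terms in the expansion of the risk around
  \<open>\<theta>hat\<close> cancel, and the risk at \<open>\<theta>hat + h\<close> exceeds the risk at \<open>\<theta>hat\<close> by
  \<open>1/n \<Sum>\<^sub>j \<parallel>\<Lambda> \<Phi>\<^sub>j h\<parallel>\<^sup>2 + \<parallel>M h\<parallel>\<^sup>2\<close>, which is positive for \<open>h \<noteq> 0\<close>.
\<close>

section \<open>Hermitian inner product, adjoint and Euclidean norm\<close>

lemma mat_adjoint_carrier [intro]:
  "A \<in> carrier_mat nr nc \<Longrightarrow> mat_adjoint A \<in> carrier_mat nc nr"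
  unfolding mat_adjoint_def by auto

lemma herm_inner_add_left:
  assumes "u \<in> carrier_vec n" "v \<in> carrier_vec n" "w \<in> carrier_vec n"
  shows "herm_inner (u + v) w = herm_inner u w + herm_inner v w"
  using assms unfolding herm_inner_def
  by (simp add: conjugate_add_vec add_scalar_prod_distrib[of _ n])

lemma herm_inner_add_right:
  assumes "u \<in> carrier_vec n" "v \<in> carrier_vec n" "w \<in> carrier_vec n"
  shows "herm_inner u (v + w) = herm_inner u v + herm_inner u w"
  using assms unfolding herm_inner_def by (simp add: scalar_prod_add_distrib[of _ n])

lemma herm_inner_diff_right:
  assumes "u \<in> carrier_vec n" "v \<in> carrier_vec n" "w \<in> carrier_vec n"
  shows "herm_inner u (v - w) = herm_inner u v - herm_inner u w"
  using assms unfolding herm_inner_def by (simp add: scalar_prod_minus_distrib[of _ n])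

lemma herm_inner_smult_right:
  assumes "u \<in> carrier_vec n" "v \<in> carrier_vec n"
  shows "herm_inner u (c \<cdot>\<^sub>v v) = c * herm_inner u v"
  using assms unfolding herm_inner_def by (simp add: scalar_prod_smult_right)

lemma herm_inner_commute:
  assumes "u \<in> carrier_vec n" "v \<in> carrier_vec n"
  shows "herm_inner v u = cnj (herm_inner u v)"
  using assms unfolding herm_inner_def scalar_prod_def
  by (auto intro!: sum.cong)

text \<open>Both sides are one double sum, with terms
  \<open>cnj (w $ i) * cnj (A $$ (k, i)) * v $ k\<close>, taken in the two orders of
  summation.\<close>

lemma herm_inner_adjoint:
  assumes A: "A \<in> carrier_mat nr nc" and v: "v \<in> carrier_vec nr" and w: "w \<in> carrier_vec nc"
  shows "herm_inner w (mat_adjoint A *\<^sub>v v) = herm_inner (A *\<^sub>v w) v"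
proof -
  have "herm_inner w (mat_adjoint A *\<^sub>v v) =
      (\<Sum>i<nc. \<Sum>k<nr. cnj (w $ i) * (cnj (A $$ (k, i)) * v $ k))"
    using assms unfolding herm_inner_def mat_adjoint_def
    by (auto simp: scalar_prod_def sum_distrib_left atLeast0LessThan intro!: sum.cong)
  also have "\<dots> = (\<Sum>k<nr. \<Sum>i<nc. cnj (w $ i) * (cnj (A $$ (k, i)) * v $ k))"
    by (rule sum.swap)
  also have "\<dots> = herm_inner (A *\<^sub>v w) v"
    using assms unfolding herm_inner_def
    by (auto simp: scalar_prod_def sum_distrib_left atLeast0LessThan mult_ac intro!: sum.cong)
  finally show ?thesis .
qed

lemma herm_inner_self: "herm_inner v v = complex_of_real ((euclid_norm v)\<^sup>2)"
proof -
  have "herm_inner v v = (\<Sum>i<dim_vec v. complex_of_real ((cmod (v $ i))\<^sup>2))"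
    unfolding herm_inner_def scalar_prod_def
    by (auto simp: atLeast0LessThan complex_norm_square[symmetric] mult.commute simp del: of_real_power
        intro!: sum.cong)
  then show ?thesis
    unfolding euclid_norm_def L2_set_def by (simp add: sum_nonneg)
qed

text \<open>The two cross terms are conjugate to each other, so they add up to twice a real
  part.\<close>

lemma euclid_norm_add_power2:
  assumes "u \<in> carrier_vec n" "w \<in> carrier_vec n"
  shows "(euclid_norm (u + w))\<^sup>2 =
    (euclid_norm u)\<^sup>2 + (euclid_norm w)\<^sup>2 + 2 * Re (herm_inner w u)"
proof -
  \<comment> \<open>The computation takes place in the complex numbers, where squared norms are
    values of \<open>herm_inner\<close>; injectivity of \<open>complex_of_real\<close> brings it
    back to the reals.\<close>
  have "complex_of_real ((euclid_norm (u + w))\<^sup>2) =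
      herm_inner u u + herm_inner w w + (herm_inner w u + cnj (herm_inner w u))"
    using assms herm_inner_commute[of w n u]
    by (simp add: herm_inner_self[symmetric] herm_inner_add_left[of _ n]
        herm_inner_add_right[of _ n] del: of_real_power)
  also have "\<dots> = complex_of_real
      ((euclid_norm u)\<^sup>2 + (euclid_norm w)\<^sup>2 + 2 * Re (herm_inner w u))"
    by (simp add: herm_inner_self complex_add_cnj)
  finally show ?thesis
    unfolding of_real_eq_iff .
qed

lemma euclid_norm_eq_0_iff:
  assumes "v \<in> carrier_vec n"
  shows "euclid_norm v = 0 \<longleftrightarrow> v = 0\<^sub>v n"
  using assms unfolding euclid_norm_def by (auto simp: L2_set_eq_0_iff)

section \<open>Kernels and inverses\<close>

lemma injective_mat_mult_eq_0_iff:
  assumes "injective_mat A" "A \<in> carrier_mat nr nc" "v \<in> carrier_vec nc"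
  shows "A *\<^sub>v v = 0\<^sub>v nr \<longleftrightarrow> v = 0\<^sub>v nc"
proof -
  have "A *\<^sub>v 0\<^sub>v nc = 0\<^sub>v nr"
    using assms(2) by auto
  then show ?thesis
    using assms inj_onD[of "(*\<^sub>v) A" "carrier_vec nc" v "0\<^sub>v nc"]
    unfolding injective_mat_def by auto
qed

text \<open>A trivial kernel forces a nonzero determinant, so \<open>A\<close> is a unit of the
  matrix ring and \<open>mat_inverse A\<close> cannot be \<open>None\<close>. This gives
  \<open>the (mat_inverse A)\<close> its meaning.\<close>

lemma mat_inverse_of_trivial_kernel:
  assumes A: "A \<in> carrier_mat n n"
    and ker: "\<And>v. v \<in> carrier_vec n \<Longrightarrow> A *\<^sub>v v = 0\<^sub>v n \<Longrightarrow> v = 0\<^sub>v n"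
  shows "A * the (mat_inverse A) = 1\<^sub>m n" "the (mat_inverse A) * A = 1\<^sub>m n"
    "the (mat_inverse A) \<in> carrier_mat n n"
proof -
  have "det A \<noteq> 0"
    using ker det_0_iff_vec_prod_zero_field[OF A] by blast
  then have "A \<in> Units (ring_mat TYPE('a) n ())"
    by (rule det_non_zero_imp_unit[OF A])
  then obtain B where "mat_inverse A = Some B"
    using mat_inverse(1)[OF A] by fastforce
  then show "A * the (mat_inverse A) = 1\<^sub>m n" "the (mat_inverse A) * A = 1\<^sub>m n"
    "the (mat_inverse A) \<in> carrier_mat n n"
    using mat_inverse(2)[OF A] by auto
qed

section \<open>Finite sums in the modules of vectors and matrices of fixed dimension\<close>

lemma finsum_module_vec_carrier:
  assumes "f \<in> F \<rightarrow> carrier_vec n"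
  shows "finsum (module_vec TYPE('a :: field) n) f F \<in> carrier_vec n"
proof -
  interpret module "class_ring :: 'a ring" "module_vec TYPE('a) n"
    by (rule vec_module)
  show ?thesis
    using finsum_closed[of f F] assms by (simp add: module_vec_simps)
qed

text \<open>Turns module sums into ordinary complex sums, by additivity in the second argument. All
  later identities between vectors are tested against \<open>herm_inner\<close> in this way.\<close>

lemma herm_inner_finsum:
  assumes "finite F" "f \<in> F \<rightarrow> carrier_vec n" "v \<in> carrier_vec n"
  shows "herm_inner v (finsum (module_vec TYPE(complex) n) f F) = (\<Sum>j\<in>F. herm_inner v (f j))"
proof -
  interpret module "class_ring :: complex ring" "module_vec TYPE(complex) n"
    by (rule vec_module)
  show ?thesis
    using assms(1,2)
  proof (induction F rule: finite_induct)
    case empty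
    then show ?case
      using assms(3) by (simp add: module_vec_simps herm_inner_def)
  next
    case (insert j F)
    then have f: "f \<in> F \<rightarrow> carrier_vec n" "f j \<in> carrier_vec n"
      by auto
    then show ?case
      using insert assms(3) finsum_module_vec_carrier[OF f(1)]
      by (simp add: finsum_insert module_vec_simps herm_inner_add_right[of _ n])
  qed
qed

lemma finsum_module_mat_carrier:
  assumes "f \<in> F \<rightarrow> carrier_mat nr nc"
  shows "finsum (module_mat TYPE('a :: comm_ring_1) nr nc) f F \<in> carrier_mat nr nc"
proof -
  interpret abelian_group "module_mat TYPE('a) nr nc"
    by (rule abelian_group_mat)
  show ?thesis
    using finsum_closed[of f F] assms by (simp add: module_mat_simps)
qed

text \<open>The action on a fixed vector is additive in the matrix; this allows the Hermitian form
  of \<open>A\<close> to be evaluated one observation at a time.\<close>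

lemma finsum_module_mat_mult_vec:
  assumes "finite F" "f \<in> F \<rightarrow> carrier_mat nr nc" "v \<in> carrier_vec nc"
  shows "finsum (module_mat TYPE('a :: field) nr nc) f F *\<^sub>v v =
    finsum (module_vec TYPE('a) nr) (\<lambda>j. f j *\<^sub>v v) F"
proof -
  interpret M: abelian_group "module_mat TYPE('a) nr nc"
    by (rule abelian_group_mat)
  interpret V: module "class_ring :: 'a ring" "module_vec TYPE('a) nr"
    by (rule vec_module)
  show ?thesis
    using assms(1,2)
  proof (induction F rule: finite_induct)
    case empty
    then show ?case
      using assms(3) by (auto simp: module_vec_simps module_mat_simps)
  next
    case (insert j F)
    then have f: "f \<in> F \<rightarrow> carrier_mat nr nc" "f j \<in> carrier_mat nr nc"
      by auto
    then have "(\<lambda>j. f j *\<^sub>v v) \<in> F \<rightarrow> carrier_vec nr" "f j *\<^sub>v v \<in> carrier_vec nr"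
      using assms(3) by (auto intro: mult_mat_vec_carrier)
    then show ?case
      using insert f assms(3) finsum_module_mat_carrier[OF f(1)]
      by (simp add: M.finsum_insert V.finsum_insert module_vec_simps module_mat_simps
          add_mult_distrib_mat_vec[of _ nr nc])
  qed
qed

section \<open>The feature matrix as the linear map behind the model\<close>

lemma feature_mat_carrier: "feature_mat d D \<phi> x \<in> carrier_mat d (\<Sum>l<d. D l)"
  unfolding feature_mat_def carrier_mat_def
  by (simp add: dim_diag_block_mat comp_def interv_sum_list_conv_sum_set_nat atLeast0LessThan
      sum_list_triv)

text \<open>Induction on the number of blocks. Splitting off the last block, rather than the first,
  leaves the offsets of all the other blocks unchanged.\<close>

lemma feature_mat_mult_vec:
  assumes "\<And>l. l < d \<Longrightarrow> \<phi> l x \<in> carrier_vec (D l)" "\<theta> \<in> carrier_vec (\<Sum>l<d. D l)"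
  shows "feature_mat d D \<phi> x *\<^sub>v \<theta> = model d D \<phi> \<theta> x"
  using assms
proof (induction d arbitrary: \<theta>)
  case 0
  then show ?case
    by (auto simp: feature_mat_def model_def)
next
  case (Suc d)
  let ?N = "\<Sum>l<d. D l"
  let ?r = "mat_of_rows (D d) [conjugate (\<phi> d x)]"
  \<comment> \<open>The vector is cut where the last block starts: the induction hypothesis handles
    \<open>a\<close>, and the new row acts on \<open>b\<close>.\<close>
  define a where "a = vec ?N (\<lambda>i. \<theta> $ i)"
  define b where "b = theta_block D d \<theta>"
  have a: "a \<in> carrier_vec ?N" and b: "b \<in> carrier_vec (D d)"
    by (simp_all add: a_def b_def theta_block_def)
  have \<theta>: "\<theta> = a @\<^sub>v b"
    using Suc.prems(2) by (intro eq_vecI) (auto simp: a_def b_def theta_block_def)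
  have F: "feature_mat d D \<phi> x \<in> carrier_mat d ?N"
    by (rule feature_mat_carrier)
  have r: "?r \<in> carrier_mat 1 (D d)"
    by auto
  have "feature_mat (Suc d) D \<phi> x =
      four_block_mat (feature_mat d D \<phi> x) (0\<^sub>m d (D d)) (0\<^sub>m 1 ?N) ?r"
    using F by (simp add: feature_mat_def diag_block_mat_last Let_def)
  moreover have "0\<^sub>m d (D d) *\<^sub>v b = 0\<^sub>v d" "0\<^sub>m 1 ?N *\<^sub>v a = 0\<^sub>v 1"
    using a b by auto
  moreover have "feature_mat d D \<phi> x *\<^sub>v a \<in> carrier_vec d" "?r *\<^sub>v b \<in> carrier_vec 1"
    using mult_mat_vec_carrier[OF F a] mult_mat_vec_carrier[OF r b] by simp_all
  ultimately have "feature_mat (Suc d) D \<phi> x *\<^sub>v \<theta> =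
      (feature_mat d D \<phi> x *\<^sub>v a) @\<^sub>v (?r *\<^sub>v b)"
    using four_block_mat_mult_vec[OF F zero_carrier_mat zero_carrier_mat r a b] by (simp add: \<theta>)
  also have "feature_mat d D \<phi> x *\<^sub>v a = model d D \<phi> a x"
    using Suc.IH a Suc.prems(1) by simp
  also have "?r *\<^sub>v b = vec 1 (\<lambda>_. herm_inner (\<phi> d x) b)"
    using Suc.prems(1)[of d] by (intro eq_vecI) (auto simp: herm_inner_def)
  also have "model d D \<phi> a x @\<^sub>v vec 1 (\<lambda>_. herm_inner (\<phi> d x) b) = model (Suc d) D \<phi> \<theta> x"
  proof -
    \<comment> \<open>Blocks before the last one lie entirely at positions below \<open>?N\<close>,
      where \<open>a\<close> and \<open>\<theta>\<close> agree.\<close>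
    have "theta_block D l a = theta_block D l \<theta>" if "l < d" for l
    proof -
      have "(\<Sum>k<l. D k) + i < ?N" if "i < D l" for i
      proof -
        have "(\<Sum>k<l. D k) + i < (\<Sum>k<Suc l. D k)"
          using that by simp
        also have "\<dots> \<le> ?N"
          using \<open>l < d\<close> by (intro sum_mono2) auto
        finally show ?thesis .
      qed
      then show ?thesis
        by (auto simp: theta_block_def a_def)
    qed
    then show ?thesis
      by (intro eq_vecI) (auto simp: model_def b_def less_Suc_eq)
  qed
  finally show ?case .
qed

text \<open>The conjunct \<open>invertible_mat A\<close> ensures that
  \<open>the (mat_inverse A)\<close> in \<open>\<theta>hat\<close> is the genuine inverse and not
  \<open>the None\<close>.\<close>

theorem proposition2p1:
  fixes n d1 d2 p q :: nat
    and D :: "nat \<Rightarrow> nat"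
    and \<phi> :: "nat \<Rightarrow> real vec \<Rightarrow> complex vec"
    and X Y :: "nat \<Rightarrow> real vec"
    and \<Lambda> M :: "complex mat"
  defines "N \<equiv> \<Sum>l<d2. D l"
  defines "\<Phi> \<equiv> \<lambda>j. feature_mat d2 D \<phi> (X j)"
  defines "A \<equiv>
      finsum (module_mat TYPE(complex) N N)
        (\<lambda>j. mat_adjoint (\<Phi> j) * mat_adjoint \<Lambda> * \<Lambda> * \<Phi> j) {..<n}
      + of_nat n \<cdot>\<^sub>m (mat_adjoint M * M)"
  defines "\<theta>hat \<equiv>
      the (mat_inverse A) *\<^sub>v
        finsum (module_vec TYPE(complex) N)
          (\<lambda>j. (mat_adjoint (\<Phi> j) * mat_adjoint \<Lambda> * \<Lambda>) *\<^sub>v map_vec complex_of_real (Y j)) {..<n}"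
  assumes "n \<ge> 1" and "d1 \<ge> 1" and "d2 \<ge> 1"
    and "\<And>j. j < n \<Longrightarrow> X j \<in> cube d1"
    and "\<And>j. j < n \<Longrightarrow> Y j \<in> carrier_vec d2"
    and "\<And>l. l < d2 \<Longrightarrow> D l \<ge> 1"
    and "\<And>l x. l < d2 \<Longrightarrow> x \<in> cube d1 \<Longrightarrow> \<phi> l x \<in> carrier_vec (D l)"
    and "\<Lambda> \<in> carrier_mat p d2" and "M \<in> carrier_mat q N"
    and "injective_mat \<Lambda>" and "injective_mat M"
  shows "invertible_mat A
    \<and> (\<exists>!\<theta>. is_arg_min (emp_risk n d2 D \<phi> X Y \<Lambda> M) (\<lambda>\<theta>. \<theta> \<in> carrier_vec N) \<theta>)
    \<and> is_arg_min (emp_risk n d2 D \<phi> X Y \<Lambda> M) (\<lambda>\<theta>. \<theta> \<in> carrier_vec N) \<theta>hat"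
proof -
  have F: "\<Phi> j \<in> carrier_mat d2 N" for j
    unfolding \<Phi>_def N_def by (rule feature_mat_carrier)
  have L: "\<Lambda> \<in> carrier_mat p d2" and M: "M \<in> carrier_mat q N"
    by fact+
  define y where "y j = map_vec complex_of_real (Y j)" for j
  have y: "y j \<in> carrier_vec d2" if "j < n" for j
    using assms(9)[OF that] by (simp add: y_def)
  \<comment> \<open>Both the risk and the form of \<open>A\<close> depend on the features only
    through these linear maps.\<close>
  define B where "B j v = \<Lambda> *\<^sub>v (\<Phi> j *\<^sub>v v)" for j v
  have B: "B j v \<in> carrier_vec p" if "v \<in> carrier_vec N" for j v
    using that F[of j] L by (auto simp: B_def intro!: mult_mat_vec_carrier)
  have B_add: "B j (u + v) = B j u + B j v" if "u \<in> carrier_vec N" "v \<in> carrier_vec N" for j u v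
    using that F[of j] L by (simp add: B_def mult_add_distrib_mat_vec[of _ _ N]
        mult_add_distrib_mat_vec[of _ _ d2])
  let ?G = "\<lambda>j. mat_adjoint (\<Phi> j) * mat_adjoint \<Lambda> * \<Lambda> * \<Phi> j"
  let ?H = "\<lambda>j. mat_adjoint (\<Phi> j) * mat_adjoint \<Lambda> * \<Lambda>"
  let ?c = "finsum (module_vec TYPE(complex) N) (\<lambda>j. ?H j *\<^sub>v y j) {..<n}"
  have H: "?H j \<in> carrier_mat N d2" for j
    using mat_adjoint_carrier[OF F[of j]] mat_adjoint_carrier[OF L] L by auto
  have G: "?G j \<in> carrier_mat N N" for j
    by (rule mult_carrier_mat[OF H F])
  have MM: "mat_adjoint M * M \<in> carrier_mat N N"
    using mat_adjoint_carrier[OF M] M by auto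
  have A: "A \<in> carrier_mat N N"
    unfolding A_def using finsum_module_mat_carrier[of ?G "{..<n}" N N] G MM by auto
  have c: "?c \<in> carrier_vec N"
    by (intro finsum_module_vec_carrier Pi_I mult_mat_vec_carrier[OF H]) (simp add: y)

  \<comment> \<open>The Hermitian form of \<open>A\<close> and the right-hand side of the normal
    equations\<close>
  have inner_H: "herm_inner h (?H j *\<^sub>v w) = herm_inner (B j h) (\<Lambda> *\<^sub>v w)"
    if h: "h \<in> carrier_vec N" and w: "w \<in> carrier_vec d2" for h w j
  proof -
    note F' = mat_adjoint_carrier[OF F[of j]] and L' = mat_adjoint_carrier[OF L]
    \<comment> \<open>The adjoints move to the left argument one after the other. The choice
      \<open>w = y j\<close> will give the summands of \<open>?c\<close>, and
      \<open>w = \<Phi> j *\<^sub>v v\<close> those of \<open>A *\<^sub>v v\<close>.\<close>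
    have "?H j *\<^sub>v w = mat_adjoint (\<Phi> j) *\<^sub>v (mat_adjoint \<Lambda> *\<^sub>v (\<Lambda> *\<^sub>v w))"
      by (simp only: assoc_mult_mat_vec[OF mult_carrier_mat[OF F' L'] L w]
          assoc_mult_mat_vec[OF F' L' mult_mat_vec_carrier[OF L w]])
    also have "herm_inner h \<dots> = herm_inner (\<Phi> j *\<^sub>v h) (mat_adjoint \<Lambda> *\<^sub>v (\<Lambda> *\<^sub>v w))"
      by (intro herm_inner_adjoint[OF F _ h] mult_mat_vec_carrier[OF L'] mult_mat_vec_carrier[OF L w])
    also have "\<dots> = herm_inner (B j h) (\<Lambda> *\<^sub>v w)"
      unfolding B_def
      by (intro herm_inner_adjoint[OF L] mult_mat_vec_carrier[OF L w] mult_mat_vec_carrier[OF F h])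
    finally show ?thesis .
  qed
  have inner_c: "herm_inner h ?c = (\<Sum>j<n. herm_inner (B j h) (\<Lambda> *\<^sub>v y j))"
    if h: "h \<in> carrier_vec N" for h
    using h y mult_mat_vec_carrier[OF H y]
    by (subst herm_inner_finsum[of _ _ N]) (auto simp: inner_H)
  have inner_A: "herm_inner h (A *\<^sub>v v) =
      (\<Sum>j<n. herm_inner (B j h) (B j v)) + of_nat n * herm_inner (M *\<^sub>v h) (M *\<^sub>v v)"
    if h: "h \<in> carrier_vec N" and v: "v \<in> carrier_vec N" for h v
  proof -
    have "A *\<^sub>v v = finsum (module_vec TYPE(complex) N) (\<lambda>j. ?G j *\<^sub>v v) {..<n}
        + of_nat n \<cdot>\<^sub>v ((mat_adjoint M * M) *\<^sub>v v)"
    proof -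
      have "A *\<^sub>v v = finsum (module_mat TYPE(complex) N N) ?G {..<n} *\<^sub>v v
          + (of_nat n \<cdot>\<^sub>m (mat_adjoint M * M)) *\<^sub>v v"
        unfolding A_def
        by (intro add_mult_distrib_mat_vec[of _ N N] finsum_module_mat_carrier Pi_I G
            smult_carrier_mat MM v)
      also have "finsum (module_mat TYPE(complex) N N) ?G {..<n} *\<^sub>v v =
          finsum (module_vec TYPE(complex) N) (\<lambda>j. ?G j *\<^sub>v v) {..<n}"
        by (intro finsum_module_mat_mult_vec[OF _ _ v] Pi_I G) simp
      also have "(of_nat n \<cdot>\<^sub>m (mat_adjoint M * M)) *\<^sub>v v =
          of_nat n \<cdot>\<^sub>v ((mat_adjoint M * M) *\<^sub>v v)"
        using MM v by (intro eq_vecI) (auto simp del: index_mult_mat)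
      finally show ?thesis .
    qed
    moreover have "finsum (module_vec TYPE(complex) N) (\<lambda>j. ?G j *\<^sub>v v) {..<n} \<in> carrier_vec N"
      by (intro finsum_module_vec_carrier Pi_I mult_mat_vec_carrier[OF G v])
    moreover have "herm_inner h (?G j *\<^sub>v v) = herm_inner (B j h) (B j v)" for j
      using inner_H[OF h, of "\<Phi> j *\<^sub>v v" j] H[of j] F[of j] v
      by (simp add: B_def assoc_mult_mat_vec[OF H F])
    moreover have "herm_inner h ((mat_adjoint M * M) *\<^sub>v v) = herm_inner (M *\<^sub>v h) (M *\<^sub>v v)"
      using herm_inner_adjoint[OF M, of "M *\<^sub>v v" h] h v M
      by (simp add: assoc_mult_mat_vec[OF mat_adjoint_carrier[OF M] M])
    moreover have "(mat_adjoint M * M) *\<^sub>v v \<in> carrier_vec N"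
      using MM v by auto
    ultimately show ?thesis
      using h herm_inner_finsum[OF finite_lessThan Pi_I[OF mult_mat_vec_carrier[OF G v]] h]
      by (simp add: herm_inner_add_right[of _ N] herm_inner_smult_right[of _ N])
  qed

  \<comment> \<open>Invertibility of \<open>A\<close>\<close>
  have ker: "v = 0\<^sub>v N" if v: "v \<in> carrier_vec N" and Av: "A *\<^sub>v v = 0\<^sub>v N" for v
  proof -
    \<comment> \<open>On the diagonal \<open>h = v\<close> the form is a sum of nonnegative terms.
      If it vanishes, so does the penalty term, and \<open>n \<ge> 1\<close> with injectivity of
      \<open>M\<close> gives \<open>v = 0\<^sub>v N\<close>.\<close>
    have "complex_of_real ((\<Sum>j<n. (euclid_norm (B j v))\<^sup>2) + real n * (euclid_norm (M *\<^sub>v v))\<^sup>2)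
        = herm_inner v (A *\<^sub>v v)"
      by (simp add: inner_A[OF v v] herm_inner_self)
    also have "\<dots> = 0"
      using v by (simp add: Av herm_inner_def)
    finally have "(\<Sum>j<n. (euclid_norm (B j v))\<^sup>2) + real n * (euclid_norm (M *\<^sub>v v))\<^sup>2 = 0"
      unfolding of_real_eq_0_iff .
    then have "real n * (euclid_norm (M *\<^sub>v v))\<^sup>2 = 0"
      by (smt (verit) sum_nonneg zero_le_power2 mult_nonneg_nonneg of_nat_0_le_iff)
    then have "M *\<^sub>v v = 0\<^sub>v q"
      using \<open>n \<ge> 1\<close> M v euclid_norm_eq_0_iff[of "M *\<^sub>v v" q] by auto
    then show ?thesis
      using injective_mat_mult_eq_0_iff[OF \<open>injective_mat M\<close> M v] by simp
  qed
  note inv = mat_inverse_of_trivial_kernel[OF A ker]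
  have invertible: "invertible_mat A"
    using A inv unfolding invertible_mat_def inverts_mat_def by auto

  \<comment> \<open>Expansion of the risk around \<open>\<theta>hat\<close>\<close>
  let ?R = "emp_risk n d2 D \<phi> X Y \<Lambda> M"
  have \<theta>hat_eq: "\<theta>hat = the (mat_inverse A) *\<^sub>v ?c"
    unfolding \<theta>hat_def y_def ..
  have \<theta>hat: "\<theta>hat \<in> carrier_vec N"
    using inv(3) c by (auto simp: \<theta>hat_eq)
  have normal_eq: "A *\<^sub>v \<theta>hat = ?c"
    using assoc_mult_mat_vec[OF A inv(3) c] inv(1) c by (simp add: \<theta>hat_eq)

  have risk: "?R \<theta> = 1 / real n * (\<Sum>j<n. (euclid_norm (B j \<theta> - \<Lambda> *\<^sub>v y j))\<^sup>2)
      + (euclid_norm (M *\<^sub>v \<theta>))\<^sup>2" if \<theta>: "\<theta> \<in> carrier_vec N" for \<theta>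
  proof -
    have "\<Lambda> *\<^sub>v (model d2 D \<phi> \<theta> (X j) - map_vec complex_of_real (Y j)) = B j \<theta> - \<Lambda> *\<^sub>v y j"
      if j: "j < n" for j
    proof -
      have "model d2 D \<phi> \<theta> (X j) = \<Phi> j *\<^sub>v \<theta>"
        \<comment> \<open>Membership of \<open>X j\<close> in the cube supplies the dimensions of
          the feature vectors \<open>\<phi> l (X j)\<close>.\<close>
        unfolding \<Phi>_def using assms(8)[OF j] assms(11) \<theta>
        by (intro feature_mat_mult_vec[symmetric]) (auto simp: N_def)
      then show ?thesis
        using F[of j] y[OF j] L \<theta>
        by (simp add: B_def y_def[symmetric] mult_minus_distrib_mat_vec[of _ p d2])
    qed
    then show ?thesis
      unfolding emp_risk_def by simp
  qed

  have pythagoras: "?R (\<theta>hat + h) = ?R \<theta>hat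
      + (1 / real n * (\<Sum>j<n. (euclid_norm (B j h))\<^sup>2) + (euclid_norm (M *\<^sub>v h))\<^sup>2)"
    if h: "h \<in> carrier_vec N" for h
  proof -
    let ?r = "\<lambda>j. B j \<theta>hat - \<Lambda> *\<^sub>v y j"
    have Ly: "\<Lambda> *\<^sub>v y j \<in> carrier_vec p" if "j < n" for j
      using L y[OF that] by auto
    have shift: "B j (\<theta>hat + h) - \<Lambda> *\<^sub>v y j = ?r j + B j h" if "j < n" for j
      using B_add[OF \<theta>hat h, of j] B[OF \<theta>hat, of j] B[OF h, of j] L
      by (intro eq_vecI) auto
    \<comment> \<open>Splitting each residual \<open>?r j\<close> separates the cross terms into the
      form of \<open>A\<close> at \<open>(h, \<theta>hat)\<close> and the pairing of
      \<open>h\<close> with \<open>?c\<close>; the normal equations make these equal.\<close>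
    have "(\<Sum>j<n. herm_inner (B j h) (?r j)) + of_nat n * herm_inner (M *\<^sub>v h) (M *\<^sub>v \<theta>hat)
        = herm_inner h (A *\<^sub>v \<theta>hat) - herm_inner h ?c"
      using B[OF \<theta>hat] B[OF h] Ly
      by (simp add: inner_A[OF h \<theta>hat] inner_c[OF h] herm_inner_diff_right[of _ p] sum_subtractf)
    then have "(\<Sum>j<n. herm_inner (B j h) (?r j)) + of_nat n * herm_inner (M *\<^sub>v h) (M *\<^sub>v \<theta>hat) = 0"
      by (simp add: normal_eq)
    from arg_cong[OF this, of Re]
    \<comment> \<open>Division by \<open>n\<close> restores the weights of the risk,
      \<open>1 / n\<close> on the data and 1 on the penalty; this is why \<open>A\<close> carries
      the factor \<open>n\<close> on its penalty part.\<close>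
    have cross: "(\<Sum>j<n. Re (herm_inner (B j h) (?r j))) / real n
        = - Re (herm_inner (M *\<^sub>v h) (M *\<^sub>v \<theta>hat))"
      using \<open>n \<ge> 1\<close> by (simp add: field_simps)
    have "(\<Sum>j<n. (euclid_norm (B j (\<theta>hat + h) - \<Lambda> *\<^sub>v y j))\<^sup>2) =
        (\<Sum>j<n. (euclid_norm (?r j))\<^sup>2) + (\<Sum>j<n. (euclid_norm (B j h))\<^sup>2)
        + 2 * (\<Sum>j<n. Re (herm_inner (B j h) (?r j)))"
      using B[OF \<theta>hat] B[OF h] Ly
      by (simp add: shift euclid_norm_add_power2[of _ p] sum.distrib sum_distrib_left)
    moreover have "(euclid_norm (M *\<^sub>v (\<theta>hat + h)))\<^sup>2 = (euclid_norm (M *\<^sub>v \<theta>hat))\<^sup>2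
        + (euclid_norm (M *\<^sub>v h))\<^sup>2 + 2 * Re (herm_inner (M *\<^sub>v h) (M *\<^sub>v \<theta>hat))"
      using M \<theta>hat h
      by (simp add: mult_add_distrib_mat_vec[of _ q N] euclid_norm_add_power2[of _ q])
    ultimately show ?thesis
      using cross \<theta>hat h by (simp add: risk add_divide_distrib)
  qed

  have less: "?R \<theta>hat < ?R \<theta>" if \<theta>: "\<theta> \<in> carrier_vec N" and neq: "\<theta> \<noteq> \<theta>hat" for \<theta>
  proof -
    define h where "h = \<theta> - \<theta>hat"
    have h: "h \<in> carrier_vec N" and sum: "\<theta>hat + h = \<theta>"
      using \<theta> \<theta>hat by (auto simp: h_def)
    have "h \<noteq> 0\<^sub>v N"
      using neq sum \<theta>hat by auto
    \<comment> \<open>Strictness comes from the penalty: by injectivity of \<open>M\<close> it is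
      positive at \<open>h\<close>.\<close>
    then have "euclid_norm (M *\<^sub>v h) \<noteq> 0"
      using injective_mat_mult_eq_0_iff[OF \<open>injective_mat M\<close> M h] M h
        euclid_norm_eq_0_iff[of "M *\<^sub>v h" q] by auto
    then show ?thesis
      using pythagoras[OF h] by (simp add: sum add_nonneg_pos sum_nonneg)
  qed
  \<comment> \<open>The strict inequality \<open>less\<close> yields both minimality and
    uniqueness.\<close>
  then have arg_min: "is_arg_min ?R (\<lambda>\<theta>. \<theta> \<in> carrier_vec N) \<theta>hat"
    using \<theta>hat unfolding is_arg_min_def by (metis less_asym)
  moreover have "\<theta> = \<theta>hat" if "is_arg_min ?R (\<lambda>\<theta>. \<theta> \<in> carrier_vec N) \<theta>" for \<theta>
    using that less \<theta>hat unfolding is_arg_min_def by blast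
  ultimately show ?thesis
    using invertible by blast
qed

end
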